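(* Let $X$ be a compact Hausdorff space which has at least one component with non-empty interior. Then there exists a compatibility isomorphism $T\colon C(X)\to C(X)$ which is discontinuous as a map from $C(X)$ to itself when $C(X)$ is equipped with the supremum-norm topology, and also discontinuous as a map from $C(X)$ to itself when $C(X)$ is equipped with the topology of pointwise convergence.
   Context: Fix a scalar field, either $\mathbb{R}$ or $\mathbb{C}$. For a topological space $X$, $C(X)$ denotes the set of all scalar-valued continuous functions on $X$. For a scalar-valued function $f$ on $X$, $\operatorname{supp} f$ is the closure of $\{x\in X\colon f(x)\neq 0\}$. The compatibility ordering on $C(X)$ is the partial order defined by: $f\preceq g$ if and only if $f(x)=g(x)$ for every $x\in\operatorname{supp} f$. A map $T\colon C(X)\to C(Y)$ (not assumed linear or continuous) is a compatibility morphism if $f\preceq g$ implies $Tf\preceq Tg$ for all $f,g\in C(X)$; a compatibility isomorphism is a bijective compatibility morphism whose inverse is also a compatibility morphism. The component of a point $x\in X$ is the union of all connected subspaces of $X$ containing $x$ (singletons are considered connected); a component of $X$ is the component of some point of $X$. *)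

theory Defs
  imports "HOL-Analysis.Analysis"
begin

text \<open>
  Spaces are abstract topologies. A function on \<open>X\<close> is represented by its unique extensional
  representative (value \<^term>\<open>undefined\<close> off \<^term>\<open>topspace X\<close>), so that equality of
  elements of \<open>C(X)\<close> is equality of functions on \<open>X\<close>.
\<close>

definition CF :: "'a topology \<Rightarrow> ('a \<Rightarrow> 'k::real_normed_field) set" where
  "CF X = {f \<in> extensional (topspace X). continuous_map X euclidean f}"

definition supp :: "'a topology \<Rightarrow> ('a \<Rightarrow> 'k::zero) \<Rightarrow> 'a set" where
  "supp X f = X closure_of {x \<in> topspace X. f x \<noteq> 0}"

definition compat_le :: "'a topology \<Rightarrow> ('a \<Rightarrow> 'k::zero) \<Rightarrow> ('a \<Rightarrow> 'k) \<Rightarrow> bool" where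
  "compat_le X f g \<longleftrightarrow> (\<forall>x\<in>supp X f. f x = g x)"

definition compat_morphism ::
    "'a topology \<Rightarrow> 'b topology \<Rightarrow> (('a \<Rightarrow> 'k::real_normed_field) \<Rightarrow> ('b \<Rightarrow> 'k)) \<Rightarrow> bool" where
  "compat_morphism X Y T \<longleftrightarrow>
     T \<in> CF X \<rightarrow> CF Y \<and>
     (\<forall>f\<in>CF X. \<forall>g\<in>CF X. compat_le X f g \<longrightarrow> compat_le Y (T f) (T g))"

definition compat_isomorphism ::
    "'a topology \<Rightarrow> 'b topology \<Rightarrow> (('a \<Rightarrow> 'k::real_normed_field) \<Rightarrow> ('b \<Rightarrow> 'k)) \<Rightarrow> bool" where
  "compat_isomorphism X Y T \<longleftrightarrow>
     bij_betw T (CF X) (CF Y) \<and> compat_morphism X Y T \<and>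
     compat_morphism Y X (inv_into (CF X) T)"

text \<open>
  The library metric space \<^const>\<open>cfunspace\<close> consists of the bounded functions in
  \<^const>\<open>CF\<close> with the supremum distance; for compact \<open>X\<close> boundedness is automatic.
\<close>

definition sup_norm_topology :: "'a topology \<Rightarrow> ('a \<Rightarrow> 'k::real_normed_field) topology" where
  "sup_norm_topology X = mtopology_of (cfunspace X euclidean_metric)"

lemma topspace_sup_norm_topology:
  assumes "compact_space X"
  shows "topspace (sup_norm_topology X) = (CF X :: ('a \<Rightarrow> 'k::real_normed_field) set)"
proof -
  have "compactin X (topspace X)"
    using assms by (simp add: compact_space_def)
  from compactin_mspace_cfunspace[OF this, of "euclidean_metric :: 'k metric"] show ?thesis
    by (auto simp: sup_norm_topology_def CF_def)
qed

lemma mdist_cfunspace_euclidean: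
  fixes f g :: "'a \<Rightarrow> 'k::real_normed_field"
  assumes "compact_space X" "topspace X \<noteq> {}" "f \<in> CF X" "g \<in> CF X"
  shows "mdist (cfunspace X euclidean_metric) f g = (SUP x\<in>topspace X. norm (f x - g x))"
proof -
  have "compactin X (topspace X)"
    using assms by (simp add: compact_space_def)
  from compactin_mspace_cfunspace[OF this, of "euclidean_metric :: 'k metric"]
  have "f \<in> mspace (cfunspace X euclidean_metric)" "g \<in> mspace (cfunspace X euclidean_metric)"
    using assms by (auto simp: CF_def)
  then have "f \<in> Metric_space.fspace UNIV dist (topspace X)"
            "g \<in> Metric_space.fspace UNIV dist (topspace X)"
    by (auto simp: Met_TC.fspace_def)
  then show ?thesis
    using assms(2)
    by (simp add: mdist_cfunspace_eq_mdist_funspace Met_TC.fdist_def dist_norm)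
qed

definition pointwise_topology :: "'a topology \<Rightarrow> ('a \<Rightarrow> 'k::real_normed_field) topology" where
  "pointwise_topology X = subtopology (product_topology (\<lambda>_. euclidean) (topspace X)) (CF X)"

lemma topspace_pointwise_topology:
  "topspace (pointwise_topology X) = (CF X :: ('a \<Rightarrow> 'k::real_normed_field) set)"
  by (auto simp: pointwise_topology_def CF_def PiE_def)

end

theory Submission
  imports Defs
begin

text \<open>
  Let \<open>K\<close> be the given component. If \<open>g\<close> has no zero on \<open>K\<close> and \<open>f\<close> lies below \<open>g\<close>, then \<open>f\<close>
  cannot vanish anywhere on \<open>K \<inter> supp f\<close>, so connectedness leaves only two options: \<open>f = g\<close> on
  \<open>K\<close>, or \<open>f = 0\<close> on \<open>K\<close> (lemma \<open>compat_le_dichotomy\<close>). Seen from \<open>K\<close>, the zero-free functions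
  are thus unrelated to one another, and the order does not notice if two of them are
  interchanged.

  Since \<open>K\<close> has an interior point \<open>x0\<close>, there is a bump function \<open>\<phi>\<close> with \<open>0 \<le> \<phi> \<le> 1\<close> and
  \<open>\<phi> x0 = 1\<close> which is zero off \<open>K\<close>. The map \<open>T\<close> adds \<open>\<phi>\<close> to the functions that equal \<open>1\<close> on
  \<open>K\<close>, subtracts \<open>\<phi>\<close> from those that equal \<open>1 + \<phi>\<close> on \<open>K\<close>, and fixes all the others. That
  \<open>\<phi>\<close> is continuous on the whole space and lives inside \<open>K\<close> keeps \<open>T f\<close> continuous, whatever
  \<open>f\<close> does elsewhere. So \<open>T\<close> is an involution of \<open>C(X)\<close>, and because \<open>1\<close> and
  \<open>1 + \<phi>\<close> are zero-free on \<open>K\<close>, it preserves the order.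

  For scalars \<open>c\<close> near but different from \<open>1\<close>, the constant function \<open>c\<close> is fixed by \<open>T\<close>,
  while the constant \<open>1\<close> is sent to a function with value \<open>2\<close> at \<open>x0\<close>. Hence \<open>T\<close> is discontinuous
  for every topology on \<open>C(X)\<close> in which the constant function depends continuously on the scalar
  and evaluation at \<open>x0\<close> is continuous (lemma \<open>swap_discontinuous\<close>). Both topologies have these
  two properties.
\<close>

section \<open>Compatibility and connected sets\<close>

lemma CF_iff: "f \<in> CF X \<longleftrightarrow> f \<in> extensional (topspace X) \<and> continuous_map X euclidean f"
  by (simp add: CF_def)

lemma mem_supp: "x \<in> topspace X \<Longrightarrow> f x \<noteq> 0 \<Longrightarrow> x \<in> supp X f"
  unfolding supp_def using closure_of_subset[of "{x \<in> topspace X. f x \<noteq> 0}" X] by auto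

lemma supp_subset_topspace: "supp X f \<subseteq> topspace X"
  by (simp add: supp_def closure_of_subset_topspace)

lemma openin_nonzero_set:
  fixes f :: "'a \<Rightarrow> 'k::real_normed_field"
  assumes "continuous_map X euclidean f"
  shows "openin X {x \<in> topspace X. f x \<noteq> 0}"
  using openin_continuous_map_preimage[OF assms, of "- {0}"] by (simp add: open_Compl)

text \<open>
  Where \<open>g\<close> has no zeros, the open set \<open>{f \<noteq> 0}\<close> coincides with the closed set \<open>supp f\<close>, because
  \<open>f = g\<close> on the latter; a connected set meets only one of it and its complement.
\<close>

lemma compat_le_dichotomy:
  fixes f g :: "'a \<Rightarrow> 'k::real_normed_field"
  assumes K: "connectedin X K" and f: "f \<in> CF X"
    and le: "compat_le X f g" and nz: "\<And>x. x \<in> K \<Longrightarrow> g x \<noteq> 0"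
  shows "(\<forall>x\<in>K. f x = g x) \<or> (\<forall>x\<in>K. f x = 0)"
proof (rule ccontr)
  assume contra: "\<not> ?thesis"
  let ?A = "{x \<in> topspace X. f x \<noteq> 0}" and ?B = "topspace X - supp X f"
  have KX: "K \<subseteq> topspace X"
    using K by (rule connectedin_subset_topspace)
  have A: "openin X ?A"
    using f by (intro openin_nonzero_set) (simp add: CF_iff)
  have B: "openin X ?B"
    by (simp add: supp_def openin_diff)
  have cover: "K \<subseteq> ?A \<union> ?B"
    using le nz KX by (auto simp: compat_le_def)
  have disj: "?A \<inter> ?B \<inter> K = {}"
    by (auto simp: mem_supp)
  have "?A \<inter> K \<noteq> {}"
    using contra KX by auto
  moreover have "?B \<inter> K \<noteq> {}"
    using contra KX le by (auto simp: compat_le_def)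
  ultimately show False
    using connectedinD[OF K A B cover disj] by blast
qed

section \<open>Swapping two zero-free germs on a connected set\<close>

locale connected_bump =
  fixes X :: "'a topology" and K :: "'a set" and \<phi> :: "'a \<Rightarrow> 'k::real_normed_field" and x0 :: 'a
  assumes connected: "connectedin X K"
    and continuous: "continuous_map X euclidean \<phi>"
    and vanishes_off: "\<And>x. x \<in> topspace X \<Longrightarrow> x \<notin> K \<Longrightarrow> \<phi> x = 0"
    and one_plus_nonzero: "\<And>x. x \<in> K \<Longrightarrow> 1 + \<phi> x \<noteq> 0"
    and x0: "x0 \<in> K" and nonzero_at: "\<phi> x0 \<noteq> 0"
begin

definition swap :: "('a \<Rightarrow> 'k) \<Rightarrow> 'a \<Rightarrow> 'k" where
  "swap f =
     (if \<forall>x\<in>K. f x = 1 then restrict (\<lambda>x. f x + \<phi> x) (topspace X)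
      else if \<forall>x\<in>K. f x = 1 + \<phi> x then restrict (\<lambda>x. f x - \<phi> x) (topspace X)
      else f)"

lemma K_subset: "K \<subseteq> topspace X"
  using connected by (rule connectedin_subset_topspace)

lemma swap_one:
  "\<forall>x\<in>K. f x = 1 \<Longrightarrow> swap f = restrict (\<lambda>x. f x + \<phi> x) (topspace X)"
  by (simp add: swap_def)

lemma swap_one_plus:
  assumes "\<forall>x\<in>K. f x = 1 + \<phi> x"
  shows "swap f = restrict (\<lambda>x. f x - \<phi> x) (topspace X)"
proof -
  have "\<not> (\<forall>x\<in>K. f x = 1)"
    using assms x0 nonzero_at by auto
  then show ?thesis
    unfolding swap_def by (simp only: if_False if_P[OF assms])
qed

lemma swap_other:
  "\<not> (\<forall>x\<in>K. f x = 1) \<Longrightarrow> \<not> (\<forall>x\<in>K. f x = 1 + \<phi> x) \<Longrightarrow> swap f = f"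
  unfolding swap_def by (simp only: if_False)

lemma swap_off: "x \<in> topspace X \<Longrightarrow> x \<notin> K \<Longrightarrow> swap f x = f x"
  by (simp add: swap_def vanishes_off)

lemma swap_in_CF:
  assumes "f \<in> CF X"
  shows "swap f \<in> CF X"
proof -
  have f: "continuous_map X euclidean f"
    using assms by (simp add: CF_iff)
  have "continuous_map X euclidean (\<lambda>x. f x + \<phi> x)" "continuous_map X euclidean (\<lambda>x. f x - \<phi> x)"
    by (intro continuous_map_add continuous_map_diff f continuous)+
  then have "restrict (\<lambda>x. f x + \<phi> x) (topspace X) \<in> CF X"
    "restrict (\<lambda>x. f x - \<phi> x) (topspace X) \<in> CF X"
    by (auto simp: CF_iff elim: continuous_map_eq)
  then show ?thesis
    using assms by (simp add: swap_def)
qed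

lemma swap_involution:
  assumes "f \<in> CF X"
  shows "swap (swap f) = f"
proof -
  have ext: "f \<in> extensional (topspace X)"
    using assms by (simp add: CF_iff)
  consider "\<forall>x\<in>K. f x = 1" | "\<forall>x\<in>K. f x = 1 + \<phi> x"
    | "\<not> (\<forall>x\<in>K. f x = 1)" "\<not> (\<forall>x\<in>K. f x = 1 + \<phi> x)"
    by blast
  then show ?thesis
  proof cases
    case 1
    then have "\<forall>x\<in>K. swap f x = 1 + \<phi> x"
      using K_subset by (auto simp: swap_one)
    then have "swap (swap f) = restrict (\<lambda>x. swap f x - \<phi> x) (topspace X)"
      by (rule swap_one_plus)
    also have "\<dots> = f"
      using ext by (intro extensionalityI[of _ "topspace X"]) (auto simp: swap_one[OF 1])
    finally show ?thesis .
  next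
    case 2
    then have "\<forall>x\<in>K. swap f x = 1"
      using K_subset by (auto simp: swap_one_plus)
    then have "swap (swap f) = restrict (\<lambda>x. swap f x + \<phi> x) (topspace X)"
      by (rule swap_one)
    also have "\<dots> = f"
      using ext by (intro extensionalityI[of _ "topspace X"]) (auto simp: swap_one_plus[OF 2])
    finally show ?thesis .
  next
    case 3
    from swap_other[OF this] show ?thesis
      by simp
  qed
qed

text \<open>Both germs that are exchanged are zero-free on \<open>K\<close>, so swapping does not move any zero.\<close>

lemma swap_eq_0_iff:
  assumes "x \<in> topspace X"
  shows "swap f x = 0 \<longleftrightarrow> f x = 0"
proof (cases "x \<in> K")
  case True
  then show ?thesis
    using assms one_plus_nonzero[OF True] by (simp add: swap_def)
next
  case False
  then show ?thesis
    using assms by (simp add: swap_off)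
qed

lemma supp_swap: "supp X (swap f) = supp X f"
  unfolding supp_def by (metis (mono_tags, lifting) swap_eq_0_iff)

text \<open>
  If \<open>f\<close> or \<open>g\<close> is changed at all, it is zero-free on \<open>K\<close>. Then either \<open>f\<close> and \<open>g\<close> agree on
  \<open>K\<close> and are changed by the same amount, or, by the dichotomy, the germ of \<open>g\<close> on \<open>K\<close>
  is exchanged while \<open>f\<close> is zero on \<open>K\<close>. In the second case the change is invisible to \<open>f\<close>: the
  open set \<open>{\<phi> \<noteq> 0} \<subseteq> K\<close> misses \<open>{f \<noteq> 0}\<close> and hence its closure.
\<close>

lemma swap_compat_le:
  assumes f: "f \<in> CF X" and le: "compat_le X f g"
  shows "compat_le X (swap f) (swap g)"
  unfolding compat_le_def supp_swap
proof
  fix x assume x: "x \<in> supp X f"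
  then have xX: "x \<in> topspace X"
    using supp_subset_topspace[of X f] by blast
  have eq: "f x = g x"
    using le x by (simp add: compat_le_def)
  \<comment> \<open>If \<open>f\<close> is zero-free on \<open>K\<close>, then \<open>K \<subseteq> supp f\<close>.\<close>
  have upward: "\<forall>y\<in>K. f y = g y" if "\<And>y. y \<in> K \<Longrightarrow> f y \<noteq> 0"
    using that le K_subset mem_supp[of _ X f] by (auto simp: compat_le_def)
  have agree: "swap f x = swap g x" if "\<forall>y\<in>K. f y = g y"
    using that eq xX by (simp add: swap_def)
  show "swap f x = swap g x"
  proof (cases "(\<forall>y\<in>K. f y = 1) \<or> (\<forall>y\<in>K. f y = 1 + \<phi> y)")
    case True
    then have "f y \<noteq> 0" if "y \<in> K" for y
      using that one_plus_nonzero by auto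
    then show ?thesis
      using upward agree by blast
  next
    case f_other: False
    show ?thesis
    proof (cases "(\<forall>y\<in>K. g y = 1) \<or> (\<forall>y\<in>K. g y = 1 + \<phi> y)")
      case True
      then have "g y \<noteq> 0" if "y \<in> K" for y
        using that one_plus_nonzero by auto
      from compat_le_dichotomy[OF connected f le this]
      consider "\<forall>y\<in>K. f y = g y" | "\<forall>y\<in>K. f y = 0"
        by blast
      then show ?thesis
      proof cases
        case 1
        then show ?thesis
          by (rule agree)
      next
        case 2
        have "{y \<in> topspace X. \<phi> y \<noteq> 0} \<inter> {y \<in> topspace X. f y \<noteq> 0} = {}"
          using 2 vanishes_off by blast
        then have "{y \<in> topspace X. \<phi> y \<noteq> 0} \<inter> supp X f = {}"
          unfolding supp_def
          by (simp add: openin_Int_closure_of_eq_empty openin_nonzero_set[OF continuous])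
        then have "\<phi> x = 0"
          using x xX by blast
        then have "swap g x = g x" "swap f x = f x"
          using xX by (simp_all add: swap_def)
        then show ?thesis
          using eq by simp
      qed
    next
      case False
      then have "swap g = g" "swap f = f"
        using f_other by (blast intro: swap_other)+
      then show ?thesis
        using eq by simp
    qed
  qed
qed

lemma compat_isomorphism_swap: "compat_isomorphism X X swap"
proof -
  have bij: "bij_betw swap (CF X) (CF X)"
    by (rule bij_betw_byWitness[where f' = swap]) (auto simp: swap_involution swap_in_CF)
  have inv: "inv_into (CF X) swap f = swap f" if "f \<in> CF X" for f
    using that bij
    by (intro inv_into_f_eq) (auto simp: swap_involution swap_in_CF bij_betw_def)
  show ?thesis
    using bij by (auto simp: compat_isomorphism_def compat_morphism_def inv swap_in_CF swap_compat_le)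
qed

text \<open>
  If \<open>swap\<close> were continuous, so would be the scalar function that sends \<open>c\<close> to the value at \<open>x0\<close>
  of the swapped constant \<open>c\<close>. Near \<open>1\<close> it is the identity, but at \<open>1\<close> it jumps by \<open>\<phi> x0\<close>.
\<close>

lemma swap_discontinuous:
  assumes const: "continuous_map euclidean \<tau> (\<lambda>c. restrict (\<lambda>_. c) (topspace X))"
    and eval: "continuous_map \<tau> euclidean (\<lambda>f. f x0)"
  shows "\<not> continuous_map \<tau> \<tau> swap"
proof
  assume "continuous_map \<tau> \<tau> swap"
  define F where "F c = swap (restrict (\<lambda>_. c) (topspace X)) x0" for c
  have "continuous_map euclidean euclidean F"
    using continuous_map_compose[OF continuous_map_compose[OF const \<open>continuous_map \<tau> \<tau> swap\<close>] eval]
    by (simp add: F_def o_def)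
  then have "F \<midarrow>1\<rightarrow> F 1"
    by (simp add: continuous_on_eq_continuous_at isCont_def)
  moreover have "F 1 = 1 + \<phi> x0"
    using x0 K_subset by (auto simp: F_def swap_def)
  moreover have "F \<midarrow>1\<rightarrow> 1"
  proof (rule Lim_transform_eventually[OF tendsto_ident_at])
    have fixed: "F c = c" if "c \<noteq> 1" "c \<noteq> 1 + \<phi> x0" for c
    proof -
      have x0X: "x0 \<in> topspace X"
        using x0 K_subset by blast
      then have "swap (restrict (\<lambda>_. c) (topspace X)) = restrict (\<lambda>_. c) (topspace X)"
        using that x0 by (intro swap_other) auto
      then show ?thesis
        using x0X by (simp add: F_def)
    qed
    have "\<forall>\<^sub>F c in at 1. c \<noteq> 1 \<and> c \<noteq> 1 + \<phi> x0"
      by (intro eventually_conj eventually_neq_at_within)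
    then show "\<forall>\<^sub>F c in at 1. c = F c"
      by eventually_elim (simp add: fixed)
  qed
  ultimately show False
    using nonzero_at tendsto_unique[of "at 1" F "1 + \<phi> x0" 1] by simp
qed

end

section \<open>Constants and evaluations in the two function topologies\<close>

lemma restrict_const_in_CF: "restrict (\<lambda>_. c) (topspace X) \<in> CF X"
  by (auto simp: CF_iff intro: continuous_map_eq[where f = "\<lambda>_. c"])

lemma continuous_map_const_pointwise:
  "continuous_map euclidean (pointwise_topology X)
     (\<lambda>c::'k::real_normed_field. restrict (\<lambda>_. c) (topspace X))"
  unfolding pointwise_topology_def continuous_map_in_subtopology
  by (auto simp: continuous_map_componentwise restrict_const_in_CF)

lemma continuous_map_eval_pointwise:
  assumes "x \<in> topspace X"
  shows "continuous_map (pointwise_topology X) euclidean (\<lambda>f. f x :: 'k::real_normed_field)"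
  unfolding pointwise_topology_def
  by (intro continuous_map_from_subtopology continuous_map_product_projection assms)

lemma mspace_cfunspace_compact:
  assumes "compact_space X"
  shows "mspace (cfunspace X euclidean_metric) = (CF X :: ('a \<Rightarrow> 'k::real_normed_field) set)"
  using topspace_sup_norm_topology[OF assms] by (simp add: sup_norm_topology_def)

lemma continuous_map_const_sup_norm:
  assumes X: "compact_space X" and ne: "topspace X \<noteq> {}"
  shows "continuous_map euclidean (sup_norm_topology X)
           (\<lambda>c::'k::real_normed_field. restrict (\<lambda>_. c) (topspace X))"
proof -
  have "mdist (cfunspace X euclidean_metric)
          (restrict (\<lambda>_. c) (topspace X)) (restrict (\<lambda>_. d) (topspace X)) = dist c d" for c d :: 'k
    using ne by (simp add: mdist_cfunspace_euclidean[OF X ne restrict_const_in_CF restrict_const_in_CF]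
      dist_norm)
  then have "Lipschitz_continuous_map euclidean_metric (cfunspace X euclidean_metric)
      (\<lambda>c::'k. restrict (\<lambda>_. c) (topspace X))"
    unfolding Lipschitz_continuous_map_def mspace_cfunspace_compact[OF X]
    by (auto simp: restrict_const_in_CF intro!: exI[of _ 1])
  from Lipschitz_continuous_imp_continuous_map[OF this] show ?thesis
    by (simp add: sup_norm_topology_def)
qed

lemma continuous_map_eval_sup_norm:
  assumes X: "compact_space X" and x: "x \<in> topspace X"
  shows "continuous_map (sup_norm_topology X) euclidean (\<lambda>f. f x :: 'k::real_normed_field)"
proof -
  have "dist (f x) (g x) \<le> mdist (cfunspace X euclidean_metric) f g"
    if f: "f \<in> CF X" and g: "g \<in> CF X" for f g :: "'a \<Rightarrow> 'k"
  proof -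
    have "continuous_map X euclidean (\<lambda>y. norm (f y - g y))"
      using f g by (intro continuous_map_norm continuous_map_diff) (auto simp: CF_iff)
    moreover have "compactin X (topspace X)"
      using X by (simp add: compact_space_def)
    ultimately have "compact ((\<lambda>y. norm (f y - g y)) ` topspace X)"
      using image_compactin by fastforce
    then have "bdd_above ((\<lambda>y. norm (f y - g y)) ` topspace X)"
      by (intro bounded_imp_bdd_above compact_imp_bounded)
    then have "norm (f x - g x) \<le> (SUP y\<in>topspace X. norm (f y - g y))"
      by (intro cSUP_upper x)
    moreover have "topspace X \<noteq> {}"
      using x by blast
    ultimately show ?thesis
      using f g by (simp add: mdist_cfunspace_euclidean[OF X] dist_norm)
  qed
  then have "Lipschitz_continuous_map (cfunspace X euclidean_metric) euclidean_metric
      (\<lambda>f. f x :: 'k)"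
    unfolding Lipschitz_continuous_map_def mspace_cfunspace_compact[OF X]
    by (auto intro!: exI[of _ 1])
  from Lipschitz_continuous_imp_continuous_map[OF this] show ?thesis
    by (simp add: sup_norm_topology_def)
qed

section \<open>Discontinuous compatibility isomorphisms\<close>

lemma bump_in_component:
  assumes "compact_space X" "Hausdorff_space X"
    and K: "K \<in> connected_components_of X" and int: "X interior_of K \<noteq> {}"
  obtains \<phi> :: "'a \<Rightarrow> 'k::real_normed_field" and x0 where "connected_bump X K \<phi> x0"
proof -
  obtain x0 where x0: "x0 \<in> X interior_of K"
    using int by blast
  have x0X: "x0 \<in> topspace X"
    using x0 interior_of_subset_topspace[of X K] by blast
  have "completely_regular_space X"
    using assms(1,2)
    by (simp add: normal_imp_completely_regular_space compact_Hausdorff_or_regular_imp_normal_space)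
  moreover have "closedin X (topspace X - X interior_of K)"
    by (simp add: closedin_diff)
  ultimately obtain u :: "'a \<Rightarrow> real" where u: "continuous_map X (top_of_set {0..1}) u"
    and u0: "u x0 = 0" and u1: "u ` (topspace X - X interior_of K) \<subseteq> {1}"
    unfolding completely_regular_space_def using x0 x0X by blast
  have ucont: "continuous_map X euclidean u" and u01: "\<And>x. x \<in> topspace X \<Longrightarrow> 0 \<le> u x \<and> u x \<le> 1"
    using u by (auto simp: continuous_map_in_subtopology)
  have KX: "K \<subseteq> topspace X"
    using connectedin_connected_components_of[OF K] by (rule connectedin_subset_topspace)
  let ?\<phi> = "\<lambda>x. of_real (1 - u x) :: 'k"
  have "connected_bump X K ?\<phi> x0"
  proof
    show "connectedin X K"
      using K by (rule connectedin_connected_components_of)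
    have "continuous_map X euclidean (\<lambda>x. 1 - u x)"
      by (intro continuous_map_diff ucont) simp
    moreover have "continuous_map euclidean euclidean (of_real :: real \<Rightarrow> 'k)"
      by (simp add: continuous_on_of_real continuous_on_id)
    ultimately show "continuous_map X euclidean ?\<phi>"
      using continuous_map_compose[of X euclidean "\<lambda>x. 1 - u x" euclidean "of_real :: real \<Rightarrow> 'k"]
      unfolding o_def by blast
    show "?\<phi> x = 0" if "x \<in> topspace X" "x \<notin> K" for x
      using that u1 interior_of_subset[of X K] by auto
    show "1 + ?\<phi> x \<noteq> 0" if "x \<in> K" for x
    proof -
      have "1 + (1 - u x) \<noteq> 0"
        using u01[of x] KX that by force
      then show ?thesis
        by (metis of_real_1 of_real_add of_real_eq_0_iff)
    qed
    show "x0 \<in> K"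
      using x0 interior_of_subset[of X K] by blast
    show "?\<phi> x0 \<noteq> 0"
      using u0 by simp
  qed
  then show ?thesis ..
qed

lemma discontinuous_compat_isomorphism:
  fixes X :: "'a topology"
  assumes X: "compact_space X" "Hausdorff_space X"
    and "\<exists>K \<in> connected_components_of X. X interior_of K \<noteq> {}"
  shows "\<exists>T :: ('a \<Rightarrow> 'k::real_normed_field) \<Rightarrow> ('a \<Rightarrow> 'k).
            compat_isomorphism X X T \<and>
            \<not> continuous_map (sup_norm_topology X) (sup_norm_topology X) T \<and>
            \<not> continuous_map (pointwise_topology X) (pointwise_topology X) T"
proof -
  obtain K where K: "K \<in> connected_components_of X" "X interior_of K \<noteq> {}"
    using assms(3) by blast
  from bump_in_component[OF X K] obtain \<phi> :: "'a \<Rightarrow> 'k" and x0 where "connected_bump X K \<phi> x0" .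
  then interpret connected_bump X K \<phi> x0 .
  have x0X: "x0 \<in> topspace X"
    using x0 K_subset by blast
  then have ne: "topspace X \<noteq> {}"
    by blast
  show ?thesis
    using compat_isomorphism_swap
      swap_discontinuous[OF continuous_map_const_sup_norm[OF X(1) ne]
        continuous_map_eval_sup_norm[OF X(1) x0X]]
      swap_discontinuous[OF continuous_map_const_pointwise continuous_map_eval_pointwise[OF x0X]]
    by blast
qed

theorem theorem1p3:
  fixes X :: "'a topology"
  assumes "compact_space X"
    and "Hausdorff_space X"
    and "\<exists>K \<in> connected_components_of X. X interior_of K \<noteq> {}"
  shows "(\<exists>T :: ('a \<Rightarrow> real) \<Rightarrow> ('a \<Rightarrow> real).
            compat_isomorphism X X T \<and>
            \<not> continuous_map (sup_norm_topology X) (sup_norm_topology X) T \<and>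
            \<not> continuous_map (pointwise_topology X) (pointwise_topology X) T) \<and>
         (\<exists>T :: ('a \<Rightarrow> complex) \<Rightarrow> ('a \<Rightarrow> complex).
            compat_isomorphism X X T \<and>
            \<not> continuous_map (sup_norm_topology X) (sup_norm_topology X) T \<and>
            \<not> continuous_map (pointwise_topology X) (pointwise_topology X) T)"
  using discontinuous_compat_isomorphism[OF assms] discontinuous_compat_isomorphism[OF assms]
  by (rule conjI)

end
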